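(* Let $T$ be a gluing of two numerical semigroups and assume that $T$ is not symmetric. The following are equivalent: (1) $T$ is GAS; (2) $T$ is 2-AGL; (3) $T=\langle 2S,b\mathbb{N}\rangle$ for some numerical semigroup $S$ that is almost symmetric but not symmetric and some odd $b\in S$.
   Context: A numerical semigroup is a submonoid $S$ of $(\mathbb{N},+)$ (with $0\in\mathbb{N}$) such that $\mathbb{N}\setminus S$ is finite. It has a unique minimal system of generators, whose elements are its minimal generators. For a numerical semigroup $S$: $F(S)=\max(\mathbb{Z}\setminus S)$, $M(S)=S\setminus\{0\}$, $K(S)=\{x\in\mathbb{N}\mid F(S)-x\notin S\}$, $PF(S)=(S-M(S))\setminus S$, where for sets $X,Y\subseteq\mathbb{Z}$, $X-Y=\{z\in\mathbb{Z}\mid z+Y\subseteq X\}$. Gluing: let $S_1=\langle s_1,\dots,s_n\rangle$ and $S_2=\langle t_1,\dots,t_m\rangle$ be numerical semigroups (possibly equal to $\mathbb{N}$) with the indicated minimal generators, and let $a\in S_2$ and $b\in S_1$ with $a$ not a minimal generator of $S_2$, $b$ not a minimal generator of $S_1$, and $\gcd(a,b)=1$. The numerical semigroup $\langle aS_1,bS_2\rangle=\langle as_1,\dots,as_n,bt_1,\dots,bt_m\rangle$ is the gluing of $S_1$ and $S_2$ with respect to $a$ and $b$. In (3), $\langle 2S,b\mathbb{N}\rangle=\{2s+bn\mid s\in S,\ n\in\mathbb{N}\}$. $S$ is symmetric if $S=K(S)$; almost symmetric if $S-M(S)=K(S)\cup\{F(S)\}$; 2-AGL if $|\langle K(S)\rangle\setminus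 K(S)|=2$, where $\langle K(S)\rangle$ is the numerical semigroup generated by $K(S)$. With $K=K(S)$ and $2K=K+K$, $S$ is GAS if either $2K=K$ or $2K\setminus K=\{F(S)-x_1,\dots,F(S)-x_r,F(S)\}$ for some $r\ge 0$ and some minimal generators $x_1,\dots,x_r$ of $S$ such that $x_i-x_j\notin PF(S)$ for every $i,j$. *)

theory Defs
  imports Main HOL.Hull "HOL-Library.Set_Algebras"
begin

text \<open>
  Subsets of the naturals are represented as sets of integers contained in
  \<open>\<nat> :: int set\<close>, so that differences such as \<open>F(S) - x\<close> are not truncated.
  Sums \<open>X + Y\<close>, translates \<open>z +o Y\<close> and dilates \<open>a *o S\<close> of sets are those of Set_Algebras.
\<close>

definition submonoid :: "int set \<Rightarrow> bool" where
  "submonoid S \<longleftrightarrow> S \<subseteq> \<nat> \<and> 0 \<in> S \<and> (\<forall>x\<in>S. \<forall>y\<in>S. x + y \<in> S)"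

definition numerical_semigroup :: "int set \<Rightarrow> bool" where
  "numerical_semigroup S \<longleftrightarrow> submonoid S \<and> finite (\<nat> - S)"

text \<open>The following is the submonoid generated by \<open>A\<close> for \<open>A \<subseteq> \<nat>\<close>; for other \<open>A\<close> it is the junk value \<open>UNIV\<close>.\<close>

definition generated :: "int set \<Rightarrow> int set" where
  "generated A = submonoid hull A"

definition minimal_system :: "int set \<Rightarrow> int set \<Rightarrow> bool" where
  "minimal_system S A \<longleftrightarrow> A \<subseteq> S \<and> generated A = S \<and> (\<forall>B. B \<subset> A \<longrightarrow> generated B \<noteq> S)"

definition minimal_generators :: "int set \<Rightarrow> int set" where
  "minimal_generators S = (THE A. minimal_system S A)"

lemma generated_least: "submonoid S \<Longrightarrow> A \<subseteq> S \<Longrightarrow> generated A \<subseteq> S"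
  unfolding generated_def by (rule hull_minimal)

lemma subset_generated: "A \<subseteq> generated A"
  unfolding generated_def by (rule hull_subset)

lemma submonoid_generated:
  assumes "A \<subseteq> \<nat>"
  shows "submonoid (generated A)"
proof -
  have "submonoid \<nat>"
    by (auto simp: submonoid_def)
  with assms have "generated A \<subseteq> \<nat>"
    by (intro generated_least)
  then show ?thesis
    using \<open>submonoid \<nat>\<close> assms unfolding generated_def hull_def submonoid_def by blast
qed

lemma minimal_system_iff:
  assumes S: "submonoid S"
  shows "minimal_system S A \<longleftrightarrow> A = {x \<in> S - {0}. x \<notin> (S - {0}) + (S - {0})}"
proof -
  define I where "I = {x \<in> S - {0}. x \<notin> (S - {0}) + (S - {0})}"
  have nonneg: "0 \<le> x" if "x \<in> S" for x
    using S that by (auto simp: submonoid_def Nats_altdef1)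
  have I_sub: "I \<subseteq> B" if "B \<subseteq> S" "generated B = S" for B
  proof
    fix x assume x: "x \<in> I"
    show "x \<in> B"
    proof (rule ccontr)
      assume "x \<notin> B"
      have "submonoid (S - {x})"
        unfolding submonoid_def
      proof (intro conjI ballI)
        show "S - {x} \<subseteq> \<nat>" "0 \<in> S - {x}"
          using S x by (auto simp: submonoid_def I_def)
        fix u v assume uv: "u \<in> S - {x}" "v \<in> S - {x}"
        have "u + v \<noteq> x"
        proof
          assume eq: "u + v = x"
          then have "u \<noteq> 0" "v \<noteq> 0" using uv by auto
          then have "x \<in> (S - {0}) + (S - {0})"
            using uv eq by (auto simp: set_plus_def)
          then show False using x by (auto simp: I_def)
        qed
        then show "u + v \<in> S - {x}"
          using S uv by (auto simp: submonoid_def)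
      qed
      then have "generated B \<subseteq> S - {x}"
        using \<open>x \<notin> B\<close> that(1) by (intro generated_least) auto
      then show False using that x by (auto simp: I_def)
    qed
  qed
  have "I \<subseteq> S" by (auto simp: I_def)
  have gI: "submonoid (generated I)"
    using S \<open>I \<subseteq> S\<close> by (intro submonoid_generated) (auto simp: submonoid_def)
  have "x \<in> S \<longrightarrow> x \<in> generated I" for x
  proof (induction "nat x" arbitrary: x rule: less_induct)
    case less
    show ?case
    proof
      assume x: "x \<in> S"
      consider "x = 0" | "x \<in> I" | u v where "u \<in> S - {0}" "v \<in> S - {0}" "x = u + v"
        using x by (auto simp: I_def set_plus_def)
      then show "x \<in> generated I"
      proof cases
        case 1
        then show ?thesis using gI by (simp add: submonoid_def)
      next
        case 2
        then show ?thesis using subset_generated by blast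
      next
        case 3
        then have "0 < u" "0 < v" using nonneg[of u] nonneg[of v] by auto
        then have "u \<in> generated I" "v \<in> generated I"
          using less[of u] less[of v] 3 by auto
        then show ?thesis using gI 3 by (simp add: submonoid_def)
      qed
    qed
  qed
  then have "generated I = S"
    using generated_least[OF S \<open>I \<subseteq> S\<close>] by blast
  then have "minimal_system S A \<longleftrightarrow> A = I"
    using I_sub \<open>I \<subseteq> S\<close> unfolding minimal_system_def
    by (metis psubset_eq subset_antisym subset_trans)
  then show ?thesis by (simp add: I_def)
qed

text \<open>The system in \<^const>\<open>minimal_generators\<close> exists and is unique:\<close>

lemma minimal_system_minimal_generators:
  assumes "submonoid S"
  shows "minimal_system S A \<longleftrightarrow> A = minimal_generators S"
  unfolding minimal_generators_def using minimal_system_iff[OF assms] by (metis the_equality)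

definition quotient :: "int set \<Rightarrow> int set \<Rightarrow> int set" where
  "quotient X Y = {z. z +o Y \<subseteq> X}"

definition M_set :: "int set \<Rightarrow> int set" where
  "M_set S = S - {0}"

text \<open>The maximum is taken over the integers, so \<open>frobenius \<nat> = -1\<close>.\<close>

definition frobenius :: "int set \<Rightarrow> int" where
  "frobenius S = (GREATEST z. z \<notin> S)"

definition K_set :: "int set \<Rightarrow> int set" where
  "K_set S = {x \<in> \<nat>. frobenius S - x \<notin> S}"

definition PF :: "int set \<Rightarrow> int set" where
  "PF S = quotient S (M_set S) - S"

definition gluing :: "int set \<Rightarrow> int set \<Rightarrow> int \<Rightarrow> int \<Rightarrow> int set" where
  "gluing S1 S2 a b = generated (a *o S1 \<union> b *o S2)"

definition is_gluing :: "int set \<Rightarrow> bool" where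
  "is_gluing T \<longleftrightarrow> (\<exists>S1 S2 a b.
     numerical_semigroup S1 \<and> numerical_semigroup S2 \<and>
     a \<in> S2 \<and> a \<notin> minimal_generators S2 \<and>
     b \<in> S1 \<and> b \<notin> minimal_generators S1 \<and>
     gcd a b = 1 \<and> T = gluing S1 S2 a b)"

definition symmetric_semigroup :: "int set \<Rightarrow> bool" where
  "symmetric_semigroup S \<longleftrightarrow> S = K_set S"

definition almost_symmetric :: "int set \<Rightarrow> bool" where
  "almost_symmetric S \<longleftrightarrow> quotient S (M_set S) = K_set S \<union> {frobenius S}"

definition two_AGL :: "int set \<Rightarrow> bool" where
  "two_AGL S \<longleftrightarrow> card (generated (K_set S) - K_set S) = 2"

text \<open>
  The finite set \<open>X\<close> below consists of the minimal generators \<open>x\<^sub>1, \<dots>, x\<^sub>r\<close>;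
  it may be empty, which is the case \<open>r = 0\<close>.
\<close>

definition GAS :: "int set \<Rightarrow> bool" where
  "GAS S \<longleftrightarrow> K_set S + K_set S = K_set S \<or>
     (\<exists>X. finite X \<and> X \<subseteq> minimal_generators S \<and>
          (\<forall>x\<in>X. \<forall>y\<in>X. x - y \<notin> PF S) \<and>
          (K_set S + K_set S) - K_set S = (\<lambda>x. frobenius S - x) ` X \<union> {frobenius S})"

end

theory Submission
  imports Defs
begin

text \<open>
  Write \<open>F\<^sub>i\<close> and \<open>K\<^sub>i\<close> for the Frobenius number and the canonical set of \<open>S\<^sub>i\<close>, and let
  \<open>T = aS\<^sub>1 + bS\<^sub>2\<close> be a gluing. Every integer is \<open>au + bv\<close>, uniquely up to replacing \<open>(u, v)\<close> by
  \<open>(u + bk, v - ak)\<close>. Hence \<open>F(T) = aF\<^sub>1 + bF\<^sub>2 + ab\<close> (\<open>frobenius_glue\<close>) and \<open>K(T) = aK\<^sub>1 + bK\<^sub>2\<close>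
  (\<open>K_glue\<close>), so that one of the \<open>S\<^sub>i\<close> is not symmetric, say \<open>S\<^sub>1\<close>.

  Then \<open>F\<^sub>1 \<in> 2K\<^sub>1\<close>, and this puts \<open>F(T) - bw\<close> into \<open>2K(T) - K(T)\<close> for every \<open>w\<close> in the Apery set
  of \<open>S\<^sub>2\<close> with respect to \<open>a\<close> (\<open>apery_in_2K\<close>). That set has \<open>a\<close> elements. If \<open>T\<close> is 2-AGL, then
  \<open>a \<le> 2\<close> at once. If \<open>T\<close> is GAS, then every nonzero \<open>w\<close> is a minimal generator of \<open>S\<^sub>2\<close>; writing
  \<open>a = c + d\<close> with \<open>0 < c \<le> d\<close> in \<open>S\<^sub>2\<close>, these \<open>a - 1\<close> generators are incongruent modulo \<open>c\<close>, so
  \<open>a - 1 \<le> c \<le> a / 2\<close> and again \<open>a \<le> 2\<close>. As \<open>a\<close> is not a minimal generator, \<open>a = 2\<close> forces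
  \<open>S\<^sub>2 = \<nat>\<close>, so \<open>T = 2S\<^sub>1 + b\<nat>\<close> with \<open>b\<close> odd.

  For such a \<open>T = 2S + b\<nat>\<close> with \<open>S\<close> not symmetric, passing from \<open>S\<close> to \<open>T\<close> replaces each
  \<open>u \<in> 2K(S) - K(S)\<close> by the two elements \<open>2u\<close> and \<open>2u + b\<close>, and likewise for the monoid generated
  by \<open>K(S)\<close> (\<open>double_diff\<close>). Almost symmetry of \<open>S\<close> says that both differences are \<open>{F(S)}\<close>
  (\<open>almost_symmetric_iff_2K\<close>, \<open>almost_symmetric_iff_generated\<close>); so it is equivalent to \<open>T\<close>
  being 2-AGL, and also to \<open>T\<close> being GAS, the generator involved being \<open>b = F(T) - 2F(S)\<close>.
\<close>

section \<open>Numerical semigroups and their canonical sets\<close>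

lemma numerical_semigroup_nonneg: "numerical_semigroup S \<Longrightarrow> x \<in> S \<Longrightarrow> 0 \<le> x"
  by (auto simp: numerical_semigroup_def submonoid_def Nats_altdef1)

lemma numerical_semigroup_zero: "numerical_semigroup S \<Longrightarrow> 0 \<in> S"
  by (simp add: numerical_semigroup_def submonoid_def)

lemma numerical_semigroup_add: "numerical_semigroup S \<Longrightarrow> x \<in> S \<Longrightarrow> y \<in> S \<Longrightarrow> x + y \<in> S"
  by (simp add: numerical_semigroup_def submonoid_def)

lemma mult_mem_of_add_closed:
  fixes b k :: int
  assumes "\<And>x. x \<in> A \<Longrightarrow> x + b \<in> A" "x \<in> A" "0 \<le> k"
  shows "x + b * k \<in> A"
  using assms(3,2)
proof (induction k rule: int_ge_induct)
  case (step k)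
  then show ?case using assms(1)[of "x + b * k"] by (simp add: algebra_simps)
qed simp

lemma numerical_semigroup_add_mult:
  "numerical_semigroup S \<Longrightarrow> x \<in> S \<Longrightarrow> b \<in> S \<Longrightarrow> 0 \<le> k \<Longrightarrow> x + b * k \<in> S"
  by (rule mult_mem_of_add_closed) (auto intro: numerical_semigroup_add)

lemma frobenius_eqI:
  assumes "f \<notin> S" "\<And>z. f < z \<Longrightarrow> z \<in> S"
  shows "frobenius S = f"
  unfolding frobenius_def using assms by (intro Greatest_equality) (auto simp: not_less[symmetric])

lemma frobenius_works:
  assumes S: "numerical_semigroup S"
  shows "frobenius S \<notin> S" and "\<And>z. frobenius S < z \<Longrightarrow> z \<in> S"
proof -
  let ?G = "insert (-1) (\<nat> - S)"
  \<comment> \<open>the gap \<open>-1\<close> accounts for the case \<open>S = \<nat>\<close>\<close>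
  define f where "f = Max ?G"
  have fin: "finite ?G" using S by (simp add: numerical_semigroup_def)
  have "f \<in> ?G" unfolding f_def by (rule Max_in[OF fin]) simp
  then have f: "f \<notin> S" using numerical_semigroup_nonneg[OF S] by force
  have above: "z \<in> S" if "f < z" for z
  proof (rule ccontr)
    assume "z \<notin> S"
    moreover have "-1 \<le> f" unfolding f_def by (rule Max_ge[OF fin]) simp
    ultimately have "z \<in> ?G" using that by (auto simp: Nats_altdef1)
    then have "z \<le> f" unfolding f_def by (rule Max_ge[OF fin])
    then show False using that by simp
  qed
  have "frobenius S = f" using f above by (rule frobenius_eqI)
  then show "frobenius S \<notin> S" and "\<And>z. frobenius S < z \<Longrightarrow> z \<in> S"
    using f above by auto
qed

text \<open>Negative integers are excluded from \<open>K(S)\<close> automatically, because \<open>F(S) - x > F(S)\<close> then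
  lies in \<open>S\<close>.\<close>

lemma mem_K_iff:
  assumes "numerical_semigroup S"
  shows "x \<in> K_set S \<longleftrightarrow> frobenius S - x \<notin> S"
  using frobenius_works(2)[OF assms, of "frobenius S - x"]
  by (force simp: K_set_def Nats_altdef1)

lemma K_subset_Nats: "K_set S \<subseteq> \<nat>"
  by (auto simp: K_set_def)

lemma frobenius_notin_K: "numerical_semigroup S \<Longrightarrow> frobenius S \<notin> K_set S"
  by (simp add: mem_K_iff numerical_semigroup_zero)

lemma K_add:
  assumes "numerical_semigroup S" "x \<in> K_set S" "s \<in> S"
  shows "x + s \<in> K_set S"
  using assms numerical_semigroup_add[OF assms(1), of "frobenius S - (x + s)" s]
  by (auto simp: mem_K_iff)

lemma zero_in_K: "numerical_semigroup S \<Longrightarrow> 0 \<in> K_set S"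
  by (simp add: mem_K_iff frobenius_works)

lemma subset_K: "numerical_semigroup S \<Longrightarrow> S \<subseteq> K_set S"
  using K_add[of S 0] zero_in_K[of S] by auto

lemma above_frobenius_in_K: "numerical_semigroup S \<Longrightarrow> frobenius S < z \<Longrightarrow> z \<in> K_set S"
  using subset_K frobenius_works(2) by blast

lemma frobenius_pos_of_not_symmetric:
  assumes S: "numerical_semigroup S" and ns: "\<not> symmetric_semigroup S"
  shows "0 < frobenius S"
proof -
  obtain x where x: "x \<in> K_set S" "x \<notin> S"
    using S ns subset_K by (auto simp: symmetric_semigroup_def)
  then have "0 \<le> x" "x \<noteq> 0" "x \<le> frobenius S"
    using numerical_semigroup_zero[OF S] frobenius_works(2)[OF S, of x]
    by (auto simp: K_set_def Nats_altdef1 not_less[symmetric])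
  then show ?thesis by linarith
qed

text \<open>A gap \<open>x\<close> for which \<open>F - x\<close> is also a gap witnesses the failure of symmetry; both \<open>x\<close> and
  \<open>F - x\<close> are then in \<open>K\<close>.\<close>

lemma frobenius_in_2K:
  assumes S: "numerical_semigroup S" and ns: "\<not> symmetric_semigroup S"
  shows "frobenius S \<in> K_set S + K_set S"
proof -
  obtain x where x: "x \<in> K_set S" "x \<notin> S"
    using S ns subset_K by (auto simp: symmetric_semigroup_def)
  then have "frobenius S - x \<in> K_set S" using S by (simp add: mem_K_iff)
  then have "x + (frobenius S - x) \<in> K_set S + K_set S" using x by (intro set_plus_intro)
  then show ?thesis by simp
qed

lemma two_K_subset_generated:
  assumes "A \<subseteq> \<nat>"
  shows "A + A \<subseteq> generated A"
  using submonoid_generated[OF assms] subset_generated[of A]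
  by (auto simp: submonoid_def set_plus_def)

lemma mem_minimal_generators_iff:
  assumes "numerical_semigroup S"
  shows "x \<in> minimal_generators S \<longleftrightarrow>
    x \<in> S \<and> x \<noteq> 0 \<and> (\<forall>u\<in>S. \<forall>v\<in>S. x = u + v \<longrightarrow> u = 0 \<or> v = 0)"
proof -
  have "minimal_generators S = {x \<in> S - {0}. x \<notin> (S - {0}) + (S - {0})}"
    using assms minimal_system_iff minimal_system_minimal_generators
    by (metis numerical_semigroup_def)
  then show ?thesis by (auto simp: set_plus_def)
qed

section \<open>Almost symmetry in terms of the canonical set\<close>

text \<open>Let \<open>Q\<close> be the quotient of \<open>S\<close> by \<open>M\<close>. Then \<open>F \<in> Q \<subseteq> K \<union> {F}\<close> for every \<open>S\<close>, so the content
  of almost symmetry is \<open>K \<subseteq> Q\<close>, that is, \<open>K + M \<subseteq> S\<close>.\<close>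

lemma almost_symmetric_iff:
  assumes S: "numerical_semigroup S"
  shows "almost_symmetric S \<longleftrightarrow> (\<forall>x\<in>K_set S. \<forall>m\<in>S. m \<noteq> 0 \<longrightarrow> x + m \<in> S)"
proof -
  let ?F = "frobenius S"
  have "z \<in> K_set S \<union> {?F}" if z: "z \<in> quotient S (M_set S)" for z
  proof (rule ccontr)
    assume n: "z \<notin> K_set S \<union> {?F}"
    then have "?F - z \<in> M_set S" using S by (auto simp: mem_K_iff M_set_def)
    then have "z + (?F - z) \<in> S" using z unfolding quotient_def by (blast intro: set_plus_intro2)
    then show False using frobenius_works[OF S] by simp
  qed
  moreover have "?F \<in> quotient S (M_set S)"
    using frobenius_works(2)[OF S] numerical_semigroup_nonneg[OF S]
    by (force simp: quotient_def M_set_def elt_set_plus_def)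
  ultimately have "almost_symmetric S \<longleftrightarrow> K_set S \<subseteq> quotient S (M_set S)"
    unfolding almost_symmetric_def by blast
  also have "\<dots> \<longleftrightarrow> (\<forall>x\<in>K_set S. \<forall>m\<in>S. m \<noteq> 0 \<longrightarrow> x + m \<in> S)"
    by (auto simp: quotient_def M_set_def elt_set_plus_def)
  finally show ?thesis .
qed

text \<open>Both sides exclude the equation \<open>x + y + m = F\<close> with \<open>x, y \<in> K\<close> and \<open>0 \<noteq> m \<in> S\<close>. Read as
  \<open>x = F - (y + m)\<close>, it says that \<open>y + m\<close> is outside \<open>S\<close>, although \<open>K + M \<subseteq> S\<close> when \<open>S\<close> is almost
  symmetric; read as \<open>m = F - (x + y)\<close>, it says that \<open>x + y\<close> is an element of \<open>2K - K\<close> other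
  than \<open>F\<close>.\<close>

lemma almost_symmetric_iff_2K:
  assumes S: "numerical_semigroup S" and ns: "\<not> symmetric_semigroup S"
  shows "almost_symmetric S \<longleftrightarrow> (K_set S + K_set S) - K_set S = {frobenius S}"
    (is "_ \<longleftrightarrow> ?D = {?F}")
proof
  assume as: "almost_symmetric S"
  have "z = ?F" if z: "z \<in> ?D" for z
  proof (rule ccontr)
    assume "z \<noteq> ?F"
    obtain x y where xy: "x \<in> K_set S" "y \<in> K_set S" "z = x + y"
      using z by (auto simp: set_plus_def)
    have "?F - z \<in> S" using z S by (simp add: mem_K_iff)
    then have "y + (?F - z) \<in> S" using as \<open>z \<noteq> ?F\<close> xy(2) S by (simp add: almost_symmetric_iff)
    then have "?F - x \<in> S" using xy(3) by simp
    then show False using xy(1) S by (simp add: mem_K_iff)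
  qed
  then show "?D = {?F}" using frobenius_in_2K[OF S ns] frobenius_notin_K[OF S] by blast
next
  assume D: "?D = {?F}"
  show "almost_symmetric S"
    unfolding almost_symmetric_iff[OF S]
  proof (intro ballI impI, rule ccontr)
    fix y m assume y: "y \<in> K_set S" and m: "m \<in> S" "m \<noteq> 0" and n: "y + m \<notin> S"
    have "?F - (y + m) \<in> K_set S" using n S by (simp add: mem_K_iff)
    then have "?F - (y + m) + y \<in> K_set S + K_set S" using y by (intro set_plus_intro)
    then have "?F - m \<in> K_set S + K_set S" by (simp add: algebra_simps)
    moreover have "?F - m \<notin> K_set S" using m S by (simp add: mem_K_iff)
    ultimately have "?F - m \<in> {?F}" using D by blast
    then show False using m by simp
  qed
qed

text \<open>If \<open>2K\<close> exceeds \<open>K\<close> only by \<open>F\<close>, then \<open>K \<union> {F}\<close> is already closed under addition, because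
  \<open>F\<close> plus a positive number exceeds \<open>F\<close>; it is then the monoid generated by \<open>K\<close>.\<close>

lemma almost_symmetric_iff_generated:
  assumes S: "numerical_semigroup S" and ns: "\<not> symmetric_semigroup S"
  shows "almost_symmetric S \<longleftrightarrow> generated (K_set S) - K_set S = {frobenius S}"
    (is "_ \<longleftrightarrow> ?D = {?F}")
proof
  assume "almost_symmetric S"
  then have D: "(K_set S + K_set S) - K_set S = {?F}"
    using almost_symmetric_iff_2K[OF S ns] by simp
  have pos: "0 < ?F" by (rule frobenius_pos_of_not_symmetric[OF S ns])
  have F_add: "?F + x \<in> K_set S \<union> {?F}" if "x \<in> K_set S \<union> {?F}" for x
  proof -
    have "x = 0 \<or> 0 < x" using that pos by (auto simp: K_set_def Nats_altdef1)
    then show ?thesis using above_frobenius_in_K[OF S, of "?F + x"] by auto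
  qed
  have KK: "x + y \<in> K_set S \<union> {?F}" if "x \<in> K_set S" "y \<in> K_set S" for x y
    using D set_plus_intro[OF that] by blast
  have "submonoid (K_set S \<union> {?F})"
    unfolding submonoid_def
  proof (intro conjI ballI)
    show "K_set S \<union> {?F} \<subseteq> \<nat>" using K_subset_Nats pos by (auto simp: Nats_altdef1)
    show "0 \<in> K_set S \<union> {?F}" using zero_in_K[OF S] by simp
    fix x y assume "x \<in> K_set S \<union> {?F}" "y \<in> K_set S \<union> {?F}"
    then show "x + y \<in> K_set S \<union> {?F}"
      using F_add KK by (metis Un_iff add.commute singletonD)
  qed
  then have "generated (K_set S) \<subseteq> K_set S \<union> {?F}" by (rule generated_least) auto
  then show "?D = {?F}"
    using two_K_subset_generated[OF K_subset_Nats, of S] frobenius_in_2K[OF S ns]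
      frobenius_notin_K[OF S] by blast
next
  assume "?D = {?F}"
  then show "almost_symmetric S"
    using almost_symmetric_iff_2K[OF S ns] two_K_subset_generated[OF K_subset_Nats, of S]
      frobenius_in_2K[OF S ns] frobenius_notin_K[OF S] by blast
qed

section \<open>Apery sets\<close>

definition apery :: "int set \<Rightarrow> int \<Rightarrow> int set" where
  "apery A a = {w \<in> A. w - a \<notin> A}"

text \<open>The least element of \<open>A\<close> in a residue class modulo \<open>a\<close> belongs to the Apery set. Both
  \<open>A = S\<close> and \<open>A = K(S)\<close> occur below.\<close>

lemma apery_representative:
  assumes A: "A \<subseteq> \<nat>" "\<And>z. c < z \<Longrightarrow> z \<in> A" and a: "0 < a"
  obtains k where "r + a * k \<in> apery A a"
proof -
  define P where "P n \<longleftrightarrow> r + a * (int n - \<bar>r\<bar>) \<in> A" for n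
  have low: "r + a * k \<notin> A" if "k < - \<bar>r\<bar>" for k
  proof -
    have "a * k \<le> 1 * k" using a that by (intro mult_right_mono_neg) auto
    then have "r + a * k < 0" using that by linarith
    then show ?thesis using A(1) by (auto simp: Nats_altdef1)
  qed
  define N where "N = \<bar>c\<bar> + \<bar>r\<bar> + 1"
  have "1 * N \<le> a * N" using a by (intro mult_right_mono) (auto simp: N_def)
  moreover have "c - r < N" by (simp add: N_def)
  ultimately have "c < r + a * N" by linarith
  then have "r + a * N \<in> A" by (rule A(2))
  moreover have "0 \<le> N" by (simp add: N_def)
  ultimately have "P (nat (N + \<bar>r\<bar>))" by (simp add: P_def)
  then have L: "P (LEAST n. P n)" by (rule LeastI)
  define n where "n = (LEAST n. P n)"
  have "r + a * (int n - \<bar>r\<bar>) - a \<notin> A"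
  proof (cases n)
    case 0
    then show ?thesis using low[of "- \<bar>r\<bar> - 1"] by (simp add: algebra_simps)
  next
    case (Suc m)
    then have "\<not> P m" using not_less_Least[of m P] by (simp add: n_def)
    then show ?thesis using Suc by (simp add: P_def algebra_simps)
  qed
  then show ?thesis using L that[of "int n - \<bar>r\<bar>"] by (simp add: apery_def P_def n_def)
qed

text \<open>If \<open>A\<close> is closed under adding \<open>a\<close>, the Apery set meets each residue class modulo \<open>a\<close> exactly
  once.\<close>

lemma card_apery:
  assumes A: "A \<subseteq> \<nat>" "\<And>z. c < z \<Longrightarrow> z \<in> A" and closed: "\<And>x. x \<in> A \<Longrightarrow> x + a \<in> A"
    and a: "0 < a"
  shows "card (apery A a) = nat a"
proof -
  have "bij_betw (\<lambda>w. w mod a) (apery A a) {0..<a}"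
  proof (rule bij_betw_imageI)
    have ordered: False
      if v: "v \<in> apery A a" "w \<in> apery A a" "v < w" and eq: "v mod a = w mod a" for v w
    proof -
      obtain k where k: "w - v = a * k"
        using mod_eq_dvd_iff[of w a v] eq by (auto simp: dvd_def)
      then have "0 < k" using v(3) a by (metis diff_gt_0_iff_gt zero_less_mult_pos)
      then have "v + a * (k - 1) \<in> A"
        using v(1) closed by (intro mult_mem_of_add_closed) (auto simp: apery_def)
      moreover have "v + a * (k - 1) = w - a" using k by (simp add: algebra_simps)
      ultimately show False using v(2) by (simp add: apery_def)
    qed
    then show "inj_on (\<lambda>w. w mod a) (apery A a)"
      by (intro inj_onI) (metis linorder_neqE)
    show "(\<lambda>w. w mod a) ` apery A a = {0..<a}"
    proof
      show "(\<lambda>w. w mod a) ` apery A a \<subseteq> {0..<a}" using a by auto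
      show "{0..<a} \<subseteq> (\<lambda>w. w mod a) ` apery A a"
      proof
        fix r assume "r \<in> {0..<a}"
        moreover obtain k where "r + a * k \<in> apery A a"
          using apery_representative[OF A a] by blast
        ultimately show "r \<in> (\<lambda>w. w mod a) ` apery A a"
          by (intro image_eqI[of _ _ "r + a * k"]) auto
      qed
    qed
  qed
  then show ?thesis by (simp add: bij_betw_same_card)
qed

section \<open>Gluings\<close>

lemma mem_glue_iff:
  fixes a b :: int
  shows "z \<in> a *o A + b *o B \<longleftrightarrow> (\<exists>u\<in>A. \<exists>v\<in>B. z = a * u + b * v)"
  by (auto simp: set_plus_def elt_set_times_def)

lemma glue_plus_glue:
  fixes a b :: int
  shows "(a *o A + b *o B) + (a *o C + b *o D) = a *o (A + C) + b *o (B + D)"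
  by (simp add: set_times_plus_distribs ac_simps)

lemma submonoid_glue:
  assumes "submonoid A" "submonoid B" "0 \<le> a" "0 \<le> b"
  shows "submonoid (a *o A + b *o B)"
  unfolding submonoid_def
proof (intro conjI ballI)
  show "a *o A + b *o B \<subseteq> \<nat>"
    using assms by (auto simp: submonoid_def mem_glue_iff Nats_altdef1 subset_iff)
  show "0 \<in> a *o A + b *o B"
    using assms by (auto simp: submonoid_def mem_glue_iff intro!: bexI[of _ 0])
  fix x y assume "x \<in> a *o A + b *o B" "y \<in> a *o A + b *o B"
  then obtain u v u' v' where *: "u \<in> A" "v \<in> B" "x = a * u + b * v"
    "u' \<in> A" "v' \<in> B" "y = a * u' + b * v'" by (auto simp: mem_glue_iff)
  then have "x + y = a * (u + u') + b * (v + v')" by (simp add: algebra_simps)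
  moreover have "u + u' \<in> A" "v + v' \<in> B" using assms * by (auto simp: submonoid_def)
  ultimately show "x + y \<in> a *o A + b *o B" unfolding mem_glue_iff by blast
qed

text \<open>The set \<open>G\<close> stands for the union of \<open>aA\<close> and \<open>bB\<close>, as in the definition of a gluing, and for
  their sum, as in the formula for \<open>K\<close> of a gluing.\<close>

lemma generated_glue_eqI:
  assumes G: "G \<subseteq> a *o generated A + b *o generated B"
    and GA: "a *o A \<subseteq> G" and GB: "b *o B \<subseteq> G"
    and AB: "A \<subseteq> \<nat>" "B \<subseteq> \<nat>" and ab: "0 \<le> a" "0 \<le> b"
  shows "generated G = a *o generated A + b *o generated B"
proof
  have sub: "submonoid (a *o generated A + b *o generated B)"
    using AB ab by (intro submonoid_glue submonoid_generated)
  then show "generated G \<subseteq> a *o generated A + b *o generated B"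
    using G by (rule generated_least)
  have "G \<subseteq> \<nat>" using sub G by (auto simp: submonoid_def)
  then have subG: "submonoid (generated G)" by (rule submonoid_generated)
  have pull: "c * x \<in> generated G"
    if C: "C \<subseteq> \<nat>" "c *o C \<subseteq> G" and x: "x \<in> generated C" for c x C
  proof -
    have "submonoid {x \<in> \<nat>. c * x \<in> generated G}"
      using subG by (auto simp: submonoid_def algebra_simps)
    moreover have "C \<subseteq> {x \<in> \<nat>. c * x \<in> generated G}"
      using C subset_generated[of G] by (auto simp: elt_set_times_def)
    ultimately show ?thesis using generated_least x by blast
  qed
  show "a *o generated A + b *o generated B \<subseteq> generated G"
  proof
    fix z assume "z \<in> a *o generated A + b *o generated B"
    then obtain u v where "u \<in> generated A" "v \<in> generated B" "z = a * u + b * v"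
      by (auto simp: mem_glue_iff)
    then show "z \<in> generated G"
      using pull[OF AB(1) GA] pull[OF AB(2) GB] subG by (simp add: submonoid_def)
  qed
qed

lemma generated_submonoid: "submonoid S \<Longrightarrow> generated S = S"
  using generated_least[of S S] subset_generated[of S] by blast

lemma generated_glue:
  assumes "A \<subseteq> \<nat>" "B \<subseteq> \<nat>" "0 \<in> A" "0 \<in> B" "0 \<le> a" "0 \<le> b"
  shows "generated (a *o A + b *o B) = a *o generated A + b *o generated B"
proof (rule generated_glue_eqI)
  show "a *o A + b *o B \<subseteq> a *o generated A + b *o generated B"
    using subset_generated by (intro set_plus_mono2 set_times_mono) auto
  show "a *o A \<subseteq> a *o A + b *o B" "b *o B \<subseteq> a *o A + b *o B"
    using assms(3,4) by (force simp: set_plus_def elt_set_times_def)+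
qed (use assms in auto)

lemma gluing_eq:
  assumes "numerical_semigroup S1" "numerical_semigroup S2" "0 \<le> a" "0 \<le> b"
  shows "gluing S1 S2 a b = a *o S1 + b *o S2"
proof -
  have sub: "submonoid S1" "submonoid S2" using assms by (auto simp: numerical_semigroup_def)
  have "generated (a *o S1 \<union> b *o S2) = a *o generated S1 + b *o generated S2"
  proof (rule generated_glue_eqI)
    show "a *o S1 \<union> b *o S2 \<subseteq> a *o generated S1 + b *o generated S2"
      using sub by (force simp: generated_submonoid submonoid_def set_plus_def elt_set_times_def)
  qed (use sub assms in \<open>auto simp: submonoid_def\<close>)
  then show ?thesis using sub by (simp add: gluing_def generated_submonoid)
qed

lemma coprime_combination:
  fixes a b z :: int
  assumes "coprime a b"
  obtains u v where "z = a * u + b * v"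
proof -
  obtain u v where "u * a + v * b = 1" using bezout_int[of a b] assms by auto
  then have "z = a * (u * z) + b * (v * z)" by (metis distrib_right mult.assoc mult.commute mult_1)
  then show ?thesis by (rule that)
qed

lemma coprime_combination_unique:
  fixes a b :: int
  assumes co: "coprime a b" and b: "0 < b" and eq: "a * u + b * v = a * u' + b * v'"
  obtains k where "u' = u + b * k" "v' = v - a * k"
proof -
  have "a * (u' - u) = b * (v - v')" using eq by (simp add: algebra_simps)
  then have "b dvd a * (u' - u)" by simp
  then have "b dvd u' - u" using co by (simp add: coprime_dvd_mult_right_iff coprime_commute)
  then obtain k where k: "u' - u = b * k" by (auto simp: dvd_def)
  then have "b * (a * k) = b * (v - v')"
    using \<open>a * (u' - u) = b * (v - v')\<close> by (simp add: algebra_simps)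
  then have "v' = v - a * k" using b by simp
  then show ?thesis using that[of k] k by simp
qed

text \<open>The Frobenius number is not in the gluing, because in any representation \<open>F = au + bv\<close> either
  \<open>u\<close> is \<open>F\<^sub>1\<close> lowered by a multiple of \<open>b \<in> S\<^sub>1\<close>, or \<open>v\<close> is \<open>F\<^sub>2\<close> lowered by a multiple of
  \<open>a \<in> S\<^sub>2\<close>.\<close>

lemma frobenius_glue_aux:
  assumes S1: "numerical_semigroup S1" and S2: "numerical_semigroup S2"
    and a: "a \<in> S2" "0 < a" and b: "b \<in> S1" "0 < b" and co: "coprime a b"
  defines "f \<equiv> a * frobenius S1 + b * frobenius S2 + a * b"
  shows "f \<notin> a *o S1 + b *o S2" and "\<And>z. f < z \<Longrightarrow> z \<in> a *o S1 + b *o S2"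
proof -
  show "f \<notin> a *o S1 + b *o S2"
  proof
    assume "f \<in> a *o S1 + b *o S2"
    then obtain u v where uv: "u \<in> S1" "v \<in> S2" "f = a * u + b * v" by (auto simp: mem_glue_iff)
    have "a * u + b * v = a * frobenius S1 + b * (frobenius S2 + a)"
      using uv by (simp add: f_def algebra_simps)
    then obtain k where k: "frobenius S1 = u + b * k" "frobenius S2 + a = v - a * k"
      using coprime_combination_unique[OF co b(2)] by blast
    show False
    proof (cases "0 \<le> k")
      case True
      then show False
        using k(1) numerical_semigroup_add_mult[OF S1 uv(1) b(1)] frobenius_works(1)[OF S1] by auto
    next
      case False
      moreover have "frobenius S2 = v + a * (- k - 1)" using k(2) by (simp add: algebra_simps)
      ultimately show False
        using numerical_semigroup_add_mult[OF S2 uv(2) a(1), of "- k - 1"]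
          frobenius_works(1)[OF S2] by auto
    qed
  qed
  fix z assume z: "f < z"
  obtain u0 v0 where z0: "z = a * u0 + b * v0" using coprime_combination[OF co] by blast
  \<comment> \<open>the representative \<open>u\<close> of \<open>u0\<close> modulo \<open>b\<close> among \<open>F\<^sub>1 + 1, \<dots>, F\<^sub>1 + b\<close>\<close>
  define q where "q = (u0 - frobenius S1 - 1) div b"
  define u where "u = u0 - b * q"
  define v where "v = v0 + a * q"
  have zuv: "z = a * u + b * v" using z0 by (simp add: u_def v_def algebra_simps)
  have "u = frobenius S1 + 1 + (u0 - frobenius S1 - 1) mod b"
    unfolding u_def q_def by (simp add: minus_div_mult_eq_mod [symmetric] algebra_simps)
  then have u: "frobenius S1 < u" "u \<le> frobenius S1 + b"
    using b(2) pos_mod_bound[of b "u0 - frobenius S1 - 1"]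
      pos_mod_sign[of b "u0 - frobenius S1 - 1"] by linarith+
  have "a * u \<le> a * (frobenius S1 + b)" using u(2) a(2) by simp
  then have "b * frobenius S2 < b * v" using z zuv by (simp add: f_def algebra_simps)
  then have "frobenius S2 < v" using b(2) by simp
  then show "z \<in> a *o S1 + b *o S2"
    unfolding mem_glue_iff using zuv u frobenius_works(2)[OF S1] frobenius_works(2)[OF S2] by blast
qed

lemma frobenius_glue:
  assumes "numerical_semigroup S1" "numerical_semigroup S2"
    and "a \<in> S2" "0 < a" "b \<in> S1" "0 < b" "coprime a b"
  shows "frobenius (a *o S1 + b *o S2) = a * frobenius S1 + b * frobenius S2 + a * b"
  using frobenius_glue_aux[OF assms] by (rule frobenius_eqI)

lemma numerical_semigroup_glue:
  assumes "numerical_semigroup S1" "numerical_semigroup S2"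
    and "a \<in> S2" "0 < a" "b \<in> S1" "0 < b" "coprime a b"
  shows "numerical_semigroup (a *o S1 + b *o S2)"
proof -
  let ?f = "a * frobenius S1 + b * frobenius S2 + a * b"
  have "\<nat> - (a *o S1 + b *o S2) \<subseteq> {0..?f}"
    using frobenius_glue_aux(2)[OF assms] by (force simp: Nats_altdef1)
  then have "finite (\<nat> - (a *o S1 + b *o S2))" by (rule finite_subset) simp
  then show ?thesis
    using assms submonoid_glue by (simp add: numerical_semigroup_def)
qed

text \<open>For \<open>z = au + bv\<close> one has \<open>F(T) - z = a(F\<^sub>1 - u) + b(F\<^sub>2 - v + a) = a(F\<^sub>1 - u + b) + b(F\<^sub>2 - v)\<close>:
  the summand \<open>ab\<close> of \<open>F(T)\<close> can be given to either side but not to both. So if \<open>F\<^sub>1 - u\<close> and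
  \<open>F\<^sub>2 - v\<close> are both gaps, no representation of \<open>F(T) - z\<close> lies in \<open>T\<close>.\<close>

lemma K_glue:
  assumes S1: "numerical_semigroup S1" and S2: "numerical_semigroup S2"
    and a: "a \<in> S2" "0 < a" and b: "b \<in> S1" "0 < b" and co: "coprime a b"
  shows "K_set (a *o S1 + b *o S2) = a *o K_set S1 + b *o K_set S2" (is "K_set ?T = ?K")
proof -
  let ?F1 = "frobenius S1" and ?F2 = "frobenius S2"
  note F = frobenius_glue[OF assms]
  note T = numerical_semigroup_glue[OF assms]
  have "z \<in> ?K" if z: "z \<in> K_set ?T" for z
  proof -
    obtain u0 v0 where z0: "z = a * u0 + b * v0" using coprime_combination[OF co] by blast
    \<comment> \<open>make \<open>u\<close> as small as \<open>u \<in> K\<^sub>1\<close> permits; then \<open>F\<^sub>1 - u + b \<in> S\<^sub>1\<close>\<close>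
    obtain k where k: "u0 + b * k \<in> apery (K_set S1) b"
      using apery_representative[OF K_subset_Nats above_frobenius_in_K[OF S1] b(2)] by blast
    define u where "u = u0 + b * k"
    define v where "v = v0 - a * k"
    have zuv: "z = a * u + b * v" using z0 by (simp add: u_def v_def algebra_simps)
    have u: "u \<in> K_set S1" "?F1 - (u - b) \<in> S1"
      using k S1 by (auto simp: u_def apery_def mem_K_iff)
    have "frobenius ?T - z \<notin> ?T" using z T by (simp add: mem_K_iff)
    moreover have "frobenius ?T - z = a * (?F1 - (u - b)) + b * (?F2 - v)"
      unfolding F by (simp add: zuv algebra_simps)
    ultimately have "?F2 - v \<notin> S2" using u(2) unfolding mem_glue_iff by blast
    then have "v \<in> K_set S2" using S2 by (simp add: mem_K_iff)
    then show ?thesis using zuv u(1) by (auto simp: mem_glue_iff)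
  qed
  moreover have "z \<in> K_set ?T" if "z \<in> ?K" for z
  proof (rule ccontr)
    assume "z \<notin> K_set ?T"
    then have "frobenius ?T - z \<in> ?T" using T by (simp add: mem_K_iff)
    then obtain s t where st: "s \<in> S1" "t \<in> S2" "frobenius ?T - z = a * s + b * t"
      by (auto simp: mem_glue_iff)
    obtain u v where uv: "u \<in> K_set S1" "v \<in> K_set S2" "z = a * u + b * v"
      using \<open>z \<in> ?K\<close> by (auto simp: mem_glue_iff)
    have "a * s + b * t = a * (?F1 - u) + b * (?F2 - v + a)"
      unfolding st(3)[symmetric] uv(3) F by (simp add: algebra_simps)
    then obtain k where k: "?F1 - u = s + b * k" "?F2 - v + a = t - a * k"
      using coprime_combination_unique[OF co b(2)] by blast
    show False
    proof (cases "0 \<le> k")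
      case True
      then show False
        using k(1) numerical_semigroup_add_mult[OF S1 st(1) b(1)] uv(1) S1 by (auto simp: mem_K_iff)
    next
      case False
      moreover have "?F2 - v = t + a * (- k - 1)" using k(2) by (simp add: algebra_simps)
      ultimately show False
        using numerical_semigroup_add_mult[OF S2 st(2) a(1), of "- k - 1"] uv(2) S2
        by (auto simp: mem_K_iff)
    qed
  qed
  ultimately show ?thesis by blast
qed

text \<open>Each \<open>w\<close> in the Apery set gives \<open>F\<^sub>2 + a - w \<in> K\<^sub>2\<close>, and
  \<open>F(T) - bw = aF\<^sub>1 + b(F\<^sub>2 + a - w)\<close> with \<open>F\<^sub>1 \<in> 2K\<^sub>1\<close>.\<close>

lemma apery_in_2K:
  assumes S1: "numerical_semigroup S1" and S2: "numerical_semigroup S2"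
    and a: "a \<in> S2" "0 < a" and b: "b \<in> S1" "0 < b" and co: "coprime a b"
    and ns: "\<not> symmetric_semigroup S1" and w: "w \<in> apery S2 a"
  defines "T \<equiv> a *o S1 + b *o S2"
  shows "frobenius T - b * w \<in> (K_set T + K_set T) - K_set T"
proof
  note gl = S1 S2 a b co
  have K2: "frobenius S2 + a - w \<in> K_set S2"
    using w S2 by (simp add: mem_K_iff apery_def)
  have "a * frobenius S1 + b * (frobenius S2 + a - w + 0)
      \<in> a *o (K_set S1 + K_set S1) + b *o (K_set S2 + K_set S2)"
    using frobenius_in_2K[OF S1 ns] set_plus_intro[OF K2 zero_in_K[OF S2]]
    unfolding mem_glue_iff by blast
  moreover have "frobenius T - b * w = a * frobenius S1 + b * (frobenius S2 + a - w + 0)"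
    unfolding T_def frobenius_glue[OF gl] by (simp add: algebra_simps)
  ultimately show "frobenius T - b * w \<in> K_set T + K_set T"
    unfolding T_def K_glue[OF gl] glue_plus_glue by simp
  have "b * w = a * 0 + b * w" by simp
  then have "b * w \<in> T"
    using w numerical_semigroup_zero[OF S1] unfolding T_def mem_glue_iff apery_def by blast
  then show "frobenius T - b * w \<notin> K_set T"
    using numerical_semigroup_glue[OF gl] by (simp add: mem_K_iff T_def)
qed

section \<open>The first factor is doubled\<close>

lemma not_minimal_generator_split:
  assumes S: "numerical_semigroup S" and a: "a \<in> S" "a \<noteq> 0" "a \<notin> minimal_generators S"
  obtains c d where "c \<in> S" "d \<in> S" "0 < c" "c \<le> d" "a = c + d"
proof -
  obtain u v where uv: "u \<in> S" "v \<in> S" "u \<noteq> 0" "v \<noteq> 0" "a = u + v"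
    using a mem_minimal_generators_iff[OF S] by blast
  then have "0 < u" "0 < v" using numerical_semigroup_nonneg[OF S] by (auto simp: order_less_le)
  then show ?thesis using that[of u v] that[of v u] uv by (cases "u \<le> v") auto
qed

text \<open>When \<open>T\<close> is 2-AGL, the \<open>a\<close> elements \<open>F(T) - bw\<close> lie in a set of size 2. When \<open>T\<close> is GAS, the
  nonzero \<open>bw\<close> are minimal generators of \<open>T\<close>, so the nonzero \<open>w\<close> are indecomposable in \<open>S\<^sub>2\<close> and
  hence incongruent modulo every nonzero \<open>c \<in> S\<^sub>2\<close>; some such \<open>c\<close> is at most \<open>a / 2\<close> because \<open>a\<close>
  is not a minimal generator.\<close>

lemma glue_factor_two:
  assumes S1: "numerical_semigroup S1" and S2: "numerical_semigroup S2"
    and a: "a \<in> S2" "a \<noteq> 0" "a \<notin> minimal_generators S2" and b: "b \<in> S1" "0 < b"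
    and co: "coprime a b" and ns: "\<not> symmetric_semigroup S1"
  defines "T \<equiv> a *o S1 + b *o S2"
  assumes or: "GAS T \<or> two_AGL T"
  shows "a = 2" and "S2 = \<nat>"
proof -
  obtain c d where cd: "c \<in> S2" "d \<in> S2" "0 < c" "c \<le> d" "a = c + d"
    using not_minimal_generator_split[OF S2 a] by blast
  then have apos: "0 < a" by simp
  note gl = S1 S2 a(1) apos b co
  have T: "numerical_semigroup T" unfolding T_def by (rule numerical_semigroup_glue[OF gl])
  note in_2K = apery_in_2K[OF gl ns, folded T_def]
  have S2N: "S2 \<subseteq> \<nat>" using S2 by (simp add: numerical_semigroup_def submonoid_def)
  have card: "card (apery S2 a) = nat a"
    using S2N frobenius_works(2)[OF S2] numerical_semigroup_add[OF S2 _ a(1)] apos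
    by (rule card_apery)
  then have fin: "finite (apery S2 a)" using apos by (auto intro: card_ge_0_finite)
  have "a \<le> 2"
    using or
  proof
    assume "two_AGL T"
    then have D: "card (generated (K_set T) - K_set T) = 2" by (simp add: two_AGL_def)
    have "inj_on (\<lambda>w. frobenius T - b * w) (apery S2 a)" using b by (auto simp: inj_on_def)
    moreover have "(\<lambda>w. frobenius T - b * w) ` apery S2 a \<subseteq> generated (K_set T) - K_set T"
      using in_2K two_K_subset_generated[OF K_subset_Nats, of T] by blast
    moreover have "finite (generated (K_set T) - K_set T)"
      using D by (auto intro: card_ge_0_finite)
    ultimately have "card (apery S2 a) \<le> 2" using D card_inj_on_le by metis
    then show ?thesis using card by simp
  next
    assume "GAS T"
    moreover have "frobenius T - b * 0 \<in> (K_set T + K_set T) - K_set T"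
      using numerical_semigroup_zero[OF S2] numerical_semigroup_nonneg[OF S2, of "-a"] apos
      by (intro in_2K) (auto simp: apery_def)
    ultimately obtain X where X: "X \<subseteq> minimal_generators T"
      "(K_set T + K_set T) - K_set T = (\<lambda>x. frobenius T - x) ` X \<union> {frobenius T}"
      unfolding GAS_def by auto
    have indec: "u = 0 \<or> v = 0" if w: "w \<in> apery S2 a" and uv: "u \<in> S2" "v \<in> S2" "w = u + v"
      for w u v
    proof (cases "w = 0")
      case True
      then show ?thesis using uv numerical_semigroup_nonneg[OF S2, of u]
          numerical_semigroup_nonneg[OF S2, of v] by auto
    next
      case False
      then have "b * w \<in> X" using in_2K[OF w] X(2) b by auto
      then have "b * w \<in> minimal_generators T" using X(1) by blast
      moreover have "b * x \<in> T" if "x \<in> S2" for x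
      proof -
        have "b * x = a * 0 + b * x" by simp
        then show ?thesis
          using that numerical_semigroup_zero[OF S1] unfolding T_def mem_glue_iff by blast
      qed
      then have "b * u \<in> T" "b * v \<in> T" using uv by auto
      moreover have "b * w = b * u + b * v" using uv(3) by (simp add: algebra_simps)
      ultimately show ?thesis using b unfolding mem_minimal_generators_iff[OF T] by force
    qed
    have ordered: False if vw: "v \<in> apery S2 a - {0}" "w \<in> apery S2 a - {0}" "v < w"
      and eq: "v mod c = w mod c" for v w
    proof -
      obtain k where k: "w - v = c * k"
        using mod_eq_dvd_iff[of w c v] eq by (auto simp: dvd_def)
      then have "0 < k" using vw(3) cd(3) by (metis diff_gt_0_iff_gt zero_less_mult_pos)
      then have "0 + c * k \<in> S2"
        using numerical_semigroup_zero[OF S2] cd(1)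
        by (intro numerical_semigroup_add_mult[OF S2]) auto
      moreover have "w = v + c * k" using k by simp
      ultimately have "v = 0 \<or> c * k = 0" using indec[of w v "c * k"] vw by (auto simp: apery_def)
      then show False using vw(1) \<open>0 < k\<close> cd(3) by auto
    qed
    then have "inj_on (\<lambda>w. w mod c) (apery S2 a - {0})"
      by (intro inj_onI) (metis linorder_neqE)
    moreover have "(\<lambda>w. w mod c) ` (apery S2 a - {0}) \<subseteq> {0..<c}" using cd(3) by auto
    ultimately have "card (apery S2 a - {0}) \<le> nat c"
      using card_inj_on_le[of _ _ "{0..<c}"] by fastforce
    moreover have "nat a - 1 \<le> card (apery S2 a - {0})"
      using card fin by (metis card_Diff1_le card_Diff_singleton_if diff_le_self order_refl)
    ultimately show ?thesis using cd by linarith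
  qed
  then have "c = 1" "d = 1" using cd by auto
  then show "a = 2" using cd by simp
  have "0 + 1 * k \<in> S2" if "0 \<le> k" for k
    using numerical_semigroup_add_mult[OF S2 numerical_semigroup_zero[OF S2] _ that] cd(1) \<open>c = 1\<close>
    by blast
  then show "S2 = \<nat>" using S2N by (auto simp: Nats_altdef1)
qed

section \<open>Gluing with the natural numbers along 2\<close>

lemma numerical_semigroup_Nats: "numerical_semigroup \<nat>"
  by (auto simp: numerical_semigroup_def submonoid_def)

lemma frobenius_Nats: "frobenius \<nat> = -1"
  by (rule frobenius_eqI) (auto simp: Nats_altdef1)

lemma K_Nats: "K_set \<nat> = \<nat>"
  unfolding set_eq_iff mem_K_iff[OF numerical_semigroup_Nats] frobenius_Nats
  by (auto simp: Nats_altdef1)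

lemma Nats_plus_Nats: "\<nat> + \<nat> = (\<nat> :: int set)"
  by (auto simp: set_plus_def intro: bexI[of _ 0])

text \<open>Moving pairs of summands \<open>b\<close> into the first component writes each element of \<open>2A + b\<nat>\<close> as
  \<open>2u + be\<close> with \<open>u \<in> A\<close> and \<open>e \<in> {0, 1}\<close>. As \<open>b\<close> is odd, \<open>u\<close> and \<open>e\<close> are unique, even among
  all integers \<open>u\<close>, so membership in \<open>2A + b\<nat>\<close> is membership of \<open>u\<close> in \<open>A\<close>.\<close>

lemma double_diff:
  assumes L: "\<And>x. x \<in> L \<Longrightarrow> x + b \<in> L" and K: "\<And>x. x \<in> K \<Longrightarrow> x + b \<in> K"
    and b: "odd (b :: int)" "0 < b"
  shows "(2 *o L + b *o \<nat>) - (2 *o K + b *o \<nat>)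
    = (\<lambda>u. 2 * u) ` (L - K) \<union> (\<lambda>u. 2 * u + b) ` (L - K)" (is "?D = ?R")
proof -
  have mem: "2 * u + b * e \<in> 2 *o A + b *o \<nat> \<longleftrightarrow> u \<in> A"
    if closed: "\<And>x. x \<in> A \<Longrightarrow> x + b \<in> A" and e: "e = 0 \<or> e = 1" for u e A
  proof
    assume "2 * u + b * e \<in> 2 *o A + b *o \<nat>"
    then obtain x n where x: "x \<in> A" "0 \<le> n" "2 * x + b * n = 2 * u + b * e"
      by (auto simp: mem_glue_iff Nats_altdef1)
    then obtain k where k: "u = x + b * k" "e = n - 2 * k"
      using coprime_combination_unique[of 2 b x n u e] b by auto
    then have "0 \<le> k" using e x(2) by auto
    then show "u \<in> A" unfolding k using closed x(1) by (intro mult_mem_of_add_closed) auto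
  next
    assume "u \<in> A"
    moreover have "e \<in> \<nat>" using e by auto
    ultimately show "2 * u + b * e \<in> 2 *o A + b *o \<nat>" unfolding mem_glue_iff by blast
  qed
  have "z \<in> ?R" if z: "z \<in> ?D" for z
  proof -
    obtain x n where x: "x \<in> L" "0 \<le> n" "z = 2 * x + b * n"
      using z by (auto simp: mem_glue_iff Nats_altdef1)
    define u where "u = x + b * (n div 2)"
    have "b * n = b * (2 * (n div 2) + n mod 2)" by simp
    also have "\<dots> = 2 * (b * (n div 2)) + b * (n mod 2)"
      by (simp only: distrib_left mult.left_commute)
    finally have zu: "z = 2 * u + b * (n mod 2)"
      unfolding x(3) u_def by (simp only: distrib_left add.assoc)
    have e: "n mod 2 = 0 \<or> n mod 2 = 1" by presburger
    have "u \<in> L" "u \<notin> K" using z mem[OF L e] mem[OF K e] zu by auto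
    then show ?thesis using e zu by auto
  qed
  moreover have "2 * u \<in> ?D" "2 * u + b \<in> ?D" if "u \<in> L - K" for u
    using mem[OF L, of 0 u] mem[OF L, of 1 u] mem[OF K, of 0 u] mem[OF K, of 1 u] that by auto
  ultimately show ?thesis by blast
qed

lemma card_double_diff:
  fixes b :: int
  assumes "odd b"
  shows "card ((\<lambda>u. 2 * u) ` D \<union> (\<lambda>u. 2 * u + b) ` D) = 2 * card D"
proof (cases "finite D")
  case True
  have "(\<lambda>u. 2 * u) ` D \<inter> (\<lambda>u. 2 * u + b) ` D = {}"
    using assms by (auto, metis even_add even_mult_iff even_numeral)
  moreover have "card ((\<lambda>u. 2 * u) ` D) = card D" "card ((\<lambda>u. 2 * u + b) ` D) = card D"
    by (auto intro!: card_image simp: inj_on_def)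
  ultimately show ?thesis using True by (simp add: card_Un_disjoint)
next
  case False
  moreover have "inj_on (\<lambda>u. 2 * u) D" by (simp add: inj_on_def)
  ultimately have "infinite ((\<lambda>u. 2 * u) ` D)" by (simp add: finite_image_iff)
  then show ?thesis using False by simp
qed

lemma card_eq_1_iff_of_mem: "x \<in> A \<Longrightarrow> card A = 1 \<longleftrightarrow> A = {x}"
  by (auto simp: card_1_singleton_iff)

text \<open>Here \<open>F(T) = 2F(S) + b\<close>, so an element \<open>2z\<close> of \<open>2K(T) - K(T)\<close> with \<open>z \<noteq> F(S)\<close> would require
  the generator \<open>2(F(S) - z) + b\<close>, which splits in \<open>T\<close>. This makes GAS as strong as
  \<open>2K(S) - K(S) = {F(S)}\<close>.\<close>

lemma double_almost_symmetric:
  assumes S: "numerical_semigroup S" and ns: "\<not> symmetric_semigroup S"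
    and b: "b \<in> S" "odd b"
  defines "T \<equiv> 2 *o S + b *o \<nat>"
  shows "two_AGL T \<longleftrightarrow> almost_symmetric S" and "GAS T \<longleftrightarrow> almost_symmetric S"
proof -
  let ?F = "frobenius S" and ?K = "K_set S"
  have bpos: "0 < b" using b numerical_semigroup_nonneg[OF S, of b] by (cases "b = 0") auto
  have gl: "numerical_semigroup S" "numerical_semigroup \<nat>" "2 \<in> (\<nat> :: int set)" "0 < (2 :: int)"
    "b \<in> S" "0 < b" "coprime 2 b"
    using S numerical_semigroup_Nats b bpos by auto
  have T: "numerical_semigroup T" unfolding T_def by (rule numerical_semigroup_glue[OF gl])
  have FT: "frobenius T = 2 * ?F + b"
    unfolding T_def frobenius_glue[OF gl] frobenius_Nats by simp
  have KT: "K_set T = 2 *o ?K + b *o \<nat>" unfolding T_def K_glue[OF gl] K_Nats ..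
  have K_b: "x + b \<in> ?K" if "x \<in> ?K" for x using K_add[OF S that b(1)] .
  have KN: "?K \<subseteq> \<nat>" by (rule K_subset_Nats)
  have "b \<in> generated ?K" using b subset_K[OF S] subset_generated[of ?K] by auto
  then have gen_b: "x + b \<in> generated ?K" if "x \<in> generated ?K" for x
    using submonoid_generated[OF KN] that by (simp add: submonoid_def)
  have two_K_b: "x + b \<in> ?K + ?K" if "x \<in> ?K + ?K" for x
    using that K_b by (auto simp: set_plus_def) (metis add.assoc)

  have "generated (K_set T) = 2 *o generated ?K + b *o \<nat>"
    unfolding KT using KN zero_in_K[OF S] bpos generated_submonoid[of \<nat>] numerical_semigroup_Nats
    by (subst generated_glue) (auto simp: numerical_semigroup_def)
  then have "card (generated (K_set T) - K_set T) = 2 * card (generated ?K - ?K)"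
    using double_diff[OF gen_b K_b b(2) bpos] card_double_diff[OF b(2)] by (simp add: KT)
  then have two: "two_AGL T \<longleftrightarrow> card (generated ?K - ?K) = 1" by (simp add: two_AGL_def)
  have "?F \<in> generated ?K - ?K"
    using two_K_subset_generated[OF KN] frobenius_in_2K[OF S ns] frobenius_notin_K[OF S] by blast
  then have "card (generated ?K - ?K) = 1 \<longleftrightarrow> generated ?K - ?K = {?F}"
    by (rule card_eq_1_iff_of_mem)
  then show "two_AGL T \<longleftrightarrow> almost_symmetric S"
    using two almost_symmetric_iff_generated[OF S ns] by simp

  have "K_set T + K_set T = 2 *o (?K + ?K) + b *o \<nat>"
    unfolding KT glue_plus_glue Nats_plus_Nats ..
  then have D: "(K_set T + K_set T) - K_set T
      = (\<lambda>u. 2 * u) ` ((?K + ?K) - ?K) \<union> (\<lambda>u. 2 * u + b) ` ((?K + ?K) - ?K)"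
    using double_diff[OF two_K_b K_b b(2) bpos] by (simp add: KT)
  have S_T: "2 * s \<in> T" if "s \<in> S" for s
  proof -
    have "2 * s = 2 * s + b * 0" by simp
    then show ?thesis using that Nats_0 unfolding T_def mem_glue_iff by blast
  qed
  have "b = 2 * 0 + b * 1" by simp
  then have b_T: "b \<in> T"
    using numerical_semigroup_zero[OF S] Nats_1 unfolding T_def mem_glue_iff by blast
  show "GAS T \<longleftrightarrow> almost_symmetric S"
  proof
    assume gas: "GAS T"
    have "z = ?F" if z: "z \<in> (?K + ?K) - ?K" for z
    proof (rule ccontr)
      assume ne: "z \<noteq> ?F"
      have zD: "2 * z \<in> (K_set T + K_set T) - K_set T" using z D by auto
      then obtain X where X: "X \<subseteq> minimal_generators T"
        "(K_set T + K_set T) - K_set T = (\<lambda>x. frobenius T - x) ` X \<union> {frobenius T}"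
        using gas unfolding GAS_def by auto
      have "2 * z \<noteq> frobenius T" using FT b(2) by presburger
      then have "2 * (?F - z) + b \<in> X" using zD X(2) FT by auto
      moreover have "2 * (?F - z) \<in> T" using z S by (intro S_T) (auto simp: mem_K_iff)
      ultimately show False
        using X(1) b_T bpos ne unfolding subset_iff mem_minimal_generators_iff[OF T] by fastforce
    qed
    then show "almost_symmetric S"
      using almost_symmetric_iff_2K[OF S ns] frobenius_in_2K[OF S ns] frobenius_notin_K[OF S]
      by blast
  next
    assume "almost_symmetric S"
    then have "(?K + ?K) - ?K = {?F}" using almost_symmetric_iff_2K[OF S ns] by simp
    then have "(K_set T + K_set T) - K_set T = (\<lambda>x. frobenius T - x) ` {b} \<union> {frobenius T}"
      unfolding D FT by auto
    moreover have "b \<in> minimal_generators T"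
      unfolding mem_minimal_generators_iff[OF T]
    proof (intro conjI ballI impI)
      show "b \<in> T" "b \<noteq> 0" using b_T bpos by auto
      fix x y assume xy: "x \<in> T" "y \<in> T" "b = x + y"
      \<comment> \<open>one summand is odd; it involves \<open>b\<close>, leaving nothing for the other\<close>
      have odd_ge: "b \<le> z" if z: "z \<in> T" "odd z" for z
      proof -
        obtain s n where sn: "s \<in> S" "0 \<le> n" "z = 2 * s + b * n"
          using z(1) unfolding T_def mem_glue_iff by (auto simp: Nats_altdef1)
        then have "n \<noteq> 0" using z(2) by auto
        then have "b * 1 \<le> b * n" using bpos sn(2) by (intro mult_left_mono) auto
        moreover have "0 \<le> s" using sn(1) by (rule numerical_semigroup_nonneg[OF S])
        ultimately show ?thesis using sn(3) by linarith
      qed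
      have "odd x \<or> odd y" using xy b(2) by auto
      then show "x = 0 \<or> y = 0"
        using odd_ge xy numerical_semigroup_nonneg[OF T] by force
    qed
    moreover have "x - x \<notin> PF T" for x
      using numerical_semigroup_zero[OF T] by (simp add: PF_def)
    ultimately show "GAS T"
      unfolding GAS_def by (intro disjI2 exI[of _ "{b}"]) auto
  qed
qed

section \<open>The characterisation\<close>

lemma symmetric_glue:
  assumes "numerical_semigroup S1" "numerical_semigroup S2"
    and "a \<in> S2" "0 < a" "b \<in> S1" "0 < b" "coprime a b"
    and "symmetric_semigroup S1" "symmetric_semigroup S2"
  shows "symmetric_semigroup (a *o S1 + b *o S2)"
  using K_glue[OF assms(1-7)] assms(8,9) by (simp add: symmetric_semigroup_def)

lemma gluing_is_double:
  assumes glue: "is_gluing T" and ns: "\<not> symmetric_semigroup T" and or: "GAS T \<or> two_AGL T"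
  obtains S b where "numerical_semigroup S" "\<not> symmetric_semigroup S" "b \<in> S" "odd b"
    "T = 2 *o S + b *o \<nat>"
proof -
  obtain S1 S2 a b where S: "numerical_semigroup S1" "numerical_semigroup S2"
    and a: "a \<in> S2" "a \<notin> minimal_generators S2" and b: "b \<in> S1" "b \<notin> minimal_generators S1"
    and gcd: "gcd a b = 1" and T: "T = gluing S1 S2 a b"
    using glue unfolding is_gluing_def by (elim exE conjE) (rule that)
  \<comment> \<open>\<open>a = 0\<close> would force \<open>b = 1\<close>, which generates minimally whenever it belongs to \<open>S\<^sub>1\<close>\<close>
  have nz: "x \<noteq> 0" if A: "numerical_semigroup A" "y \<in> A" "y \<notin> minimal_generators A"
    and g: "gcd x y = 1" for x y A
  proof
    assume "x = 0"
    then have "y = 1" using g numerical_semigroup_nonneg[OF A(1,2)] by simp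
    then have "y \<noteq> 0" by simp
    then obtain c d where "0 < c" "c \<le> d" "y = c + d"
      using not_minimal_generator_split[OF A(1,2) _ A(3)] by blast
    then show False using \<open>y = 1\<close> by simp
  qed
  have "a \<noteq> 0" using nz[OF S(1) b gcd] .
  moreover have "b \<noteq> 0" using nz[OF S(2) a] gcd by (simp add: gcd.commute)
  moreover note numerical_semigroup_nonneg[OF S(2) a(1)] numerical_semigroup_nonneg[OF S(1) b(1)]
  ultimately have pos: "0 < a" "0 < b" by auto
  have co: "coprime a b" "coprime b a" using gcd by (auto simp: coprime_iff_gcd_eq_1 gcd.commute)
  have T1: "T = a *o S1 + b *o S2" using gluing_eq S pos T by simp
  then have T2: "T = b *o S2 + a *o S1" by (simp add: add.commute)
  have "\<not> symmetric_semigroup S1 \<or> \<not> symmetric_semigroup S2"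
    using symmetric_glue[OF S a(1) pos(1) b(1) pos(2) co(1)] ns T1 by blast
  then show ?thesis
  proof
    assume n: "\<not> symmetric_semigroup S1"
    note two = glue_factor_two[OF S a(1) \<open>a \<noteq> 0\<close> a(2) b(1) pos(2) co(1) n or[unfolded T1]]
    show ?thesis using that[OF S(1) n b(1)] T1 two co by simp
  next
    assume n: "\<not> symmetric_semigroup S2"
    note two = glue_factor_two[OF S(2,1) b(1) \<open>b \<noteq> 0\<close> b(2) a(1) pos(1) co(2) n or[unfolded T2]]
    show ?thesis using that[OF S(2) n a(1)] T2 two co by simp
  qed
qed

theorem theorem4p1:
  fixes T :: "int set"
  assumes "is_gluing T" and "\<not> symmetric_semigroup T"
  shows "(GAS T \<longleftrightarrow> two_AGL T) \<and>
    (two_AGL T \<longleftrightarrow>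
      (\<exists>S b. numerical_semigroup S \<and> almost_symmetric S \<and> \<not> symmetric_semigroup S \<and>
             b \<in> S \<and> odd b \<and> T = {2 * s + b * n | s n. s \<in> S \<and> n \<in> \<nat>}))"
proof -
  have double: "{2 * s + b * n | s n. s \<in> S \<and> n \<in> \<nat>} = 2 *o S + b *o \<nat>" for S and b :: int
    by (auto simp: set_eq_iff mem_glue_iff)
  show ?thesis
    unfolding double
    using gluing_is_double[OF assms] double_almost_symmetric by metis
qed

end
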